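(* Assume that for each $y\in\mathcal Y$, $L_y$ is the infinitesimal generator of an $M/M/C/C$ queue with $K$ classes of customers having capacity requirements $A_k$ and arrival-to-service rate ratios $\rho_k(y)=\varphi_k([I_k,y])$ for $k=1,\dots,K$, where the $\varphi_k$ are positive $C^1$ functions on $\mathbb R$. Set $\rho(y)=(\rho_k(y),\,1\le k\le K)$ for $y\in\mathcal Y$. Then the function $$g(y)=h(y\,|\,\nu_{\rho(y)})-\log Z(\rho(y))+\sum_{k=1}^K\psi_k([I_k,y]),$$ where, for $k=1,\dots,K$, $\psi_k$ is some primitive of $x\mapsto x\,\dfrac{\varphi_k'(x)}{\varphi_k(x)}$, is a Lyapunov function for the dynamical system $\dot y=yL_y$ on $\mathcal Y$.
   Context: $K\ge1$, $C\ge1$ and $1\le A_k\le C$ are integers. $\mathcal X=\{n\in\mathbb N^K:\sum_{k}n_kA_k\le C\}$ (with $0\in\mathbb N$); $\mathcal Y=\{y\in[0,+\infty)^{\mathcal X}:\sum_{n\in\mathcal X}y_n=1\}$ is the set of probability measures on $\mathcal X$; $[I_k,y]=\sum_{n\in\mathcal X}n_ky_n$; $f_k$ is the $k$-th unit vector of $\mathbb R^K$. The generator of the $M/M/C/C$ queue with $K$ classes, arrival rates $a_k>0$, service rates $b_k>0$ and capacity requirements $A_k$ is the rate matrix $L$ on $\mathcal X$ with $L(n,n+f_k)=a_k$ if $n+f_k\in\mathcal X$, $L(n,n-f_k)=b_kn_k$ if $n_k\ge1$, other off-diagonal entries $0$, and rows summing to $0$. For $L_y$ the arrival-to-service rate ratios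 are $a_k/b_k=\rho_k(y)$. For $\rho\in(0,\infty)^K$ and $n\in\mathcal X$: $\rho^n=\prod_k\rho_k^{n_k}$, $n!=\prod_kn_k!$, $Z(\rho)=\sum_{n\in\mathcal X}\rho^n/n!$, and $\nu_\rho(n)=\frac1{Z(\rho)}\frac{\rho^n}{n!}$ (the reversible distribution of the queue with ratios $\rho_k$). Relative entropy: $h(y|y')=\sum_{n\in\mathcal X}y_n\log\frac{y_n}{y_n'}$. $yL_y$ is the product of the row vector $y$ by the matrix $L_y$, and $yL_y\nabla g(y)=\sum_{n\in\mathcal X}(yL_y)_n\frac{\partial g}{\partial y_n}(y)$. A Lyapunov function for $\dot y=yL_y$ is a continuously differentiable, bounded from below, function $g$ defined on $[0,+\infty)^{\mathcal X}$ such that $yL_y\nabla g(y)\le0$ for all $y\in\mathcal Y$, where equality holds only if $yL_y=0$, i.e. only if $y$ is an equilibrium point of the dynamics.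
   Formalization: "Continuously differentiable" allows partial derivative −∞ where y_n = 0 (y log y has slope −∞ there), with yL_y∇g(y) taken in extended reals and 0·∞ = 0; "bounded from below" is claimed only on 𝒴, since it can fail on [0,∞)^𝒳. *)

theory Defs
  imports "HOL-Analysis.Analysis"
begin

section \<open>State space and measures\<close>

definition states :: "nat \<Rightarrow> nat ^ 'k \<Rightarrow> (nat ^ 'k) set" where
  "states C A = {n. (\<Sum>k\<in>UNIV. n $ k * A $ k) \<le> C}"

text \<open>For a finite set \<open>X\<close>, the space \<open>\<real>\<^sup>X\<close> is rendered by the functions on \<open>X\<close> that are
  extensional (undefined outside \<open>X\<close>), with the product topology.\<close>

abbreviation orthant :: "'s set \<Rightarrow> ('s \<Rightarrow> real) set" where
  "orthant X \<equiv> X \<rightarrow>\<^sub>E {0..}"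

definition prob_vectors :: "'s set \<Rightarrow> ('s \<Rightarrow> real) set" where
  "prob_vectors X = {y \<in> orthant X. (\<Sum>n\<in>X. y n) = 1}"

definition mean :: "(nat ^ 'k) set \<Rightarrow> 'k \<Rightarrow> (nat ^ 'k \<Rightarrow> real) \<Rightarrow> real" where
  "mean X k y = (\<Sum>n\<in>X. real (n $ k) * y n)"


section \<open>The multiclass loss queue\<close>

definition queue_generator ::
  "nat \<Rightarrow> nat ^ 'k \<Rightarrow> real ^ 'k \<Rightarrow> real ^ 'k \<Rightarrow> (nat ^ 'k \<Rightarrow> nat ^ 'k \<Rightarrow> real) \<Rightarrow> bool" where
  "queue_generator C A a b L \<longleftrightarrow>
    (\<forall>n \<in> states C A.
      (\<forall>k. n + axis k 1 \<in> states C A \<longrightarrow> L n (n + axis k 1) = a $ k) \<and>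
      (\<forall>k. n $ k \<ge> 1 \<longrightarrow> L n (n - axis k 1) = b $ k * real (n $ k)) \<and>
      (\<forall>m \<in> states C A. m \<noteq> n \<and> (\<forall>k. m \<noteq> n + axis k 1) \<and>
          (\<forall>k. n $ k \<ge> 1 \<longrightarrow> m \<noteq> n - axis k 1) \<longrightarrow> L n m = 0) \<and>
      (\<Sum>m \<in> states C A. L n m) = 0)"

definition stationary_weight :: "real ^ 'k \<Rightarrow> nat ^ 'k \<Rightarrow> real" where
  "stationary_weight \<rho> n = (\<Prod>k\<in>UNIV. (\<rho> $ k) ^ (n $ k)) / (\<Prod>k\<in>UNIV. fact (n $ k))"

definition partition_function :: "(nat ^ 'k) set \<Rightarrow> real ^ 'k \<Rightarrow> real" where
  "partition_function X \<rho> = (\<Sum>n\<in>X. stationary_weight \<rho> n)"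

definition reversible_dist :: "(nat ^ 'k) set \<Rightarrow> real ^ 'k \<Rightarrow> nat ^ 'k \<Rightarrow> real" where
  "reversible_dist X \<rho> n = stationary_weight \<rho> n / partition_function X \<rho>"

text \<open>A term with \<open>y n = 0\<close> contributes \<open>0\<close>, the usual convention.\<close>

definition relative_entropy :: "'s set \<Rightarrow> ('s \<Rightarrow> real) \<Rightarrow> ('s \<Rightarrow> real) \<Rightarrow> real" where
  "relative_entropy X y y' = (\<Sum>n\<in>X. y n * ln (y n / y' n))"


section \<open>Lyapunov functions\<close>

definition row_mult :: "'s set \<Rightarrow> ('s \<Rightarrow> real) \<Rightarrow> ('s \<Rightarrow> 's \<Rightarrow> real) \<Rightarrow> 's \<Rightarrow> real" where
  "row_mult X y L n = (\<Sum>m\<in>X. y m * L m n)"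

text \<open>Partial derivatives relative to the orthant: two-sided where \<open>y n > 0\<close>, one-sided
  where \<open>y n = 0\<close>. They are extended reals because \<open>t \<mapsto> t * ln t\<close> has slope \<open>-\<infinity>\<close> at \<open>0\<close>.\<close>

definition has_partial_deriv ::
  "(('s \<Rightarrow> real) \<Rightarrow> real) \<Rightarrow> 's \<Rightarrow> ('s \<Rightarrow> real) \<Rightarrow> ereal \<Rightarrow> bool" where
  "has_partial_deriv g n y D \<longleftrightarrow>
    ((\<lambda>t. ereal ((g (y(n := t)) - g y) / (t - y n))) \<longlongrightarrow> D) (at (y n) within {0..})"

definition partial_deriv :: "(('s \<Rightarrow> real) \<Rightarrow> real) \<Rightarrow> 's \<Rightarrow> ('s \<Rightarrow> real) \<Rightarrow> ereal" where
  "partial_deriv g n y = (THE D. has_partial_deriv g n y D)"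

text \<open>Continuous differentiability on the closed orthant. On the open orthant this is ordinary
  \<open>C\<^sup>1\<close>: the partial derivatives exist, are finite and are continuous. The only relaxation is
  that a partial derivative may be \<open>-\<infinity>\<close> at points where its own coordinate vanishes, in which
  case it is still continuous there as an extended-real function.\<close>

definition C1_on_orthant :: "'s set \<Rightarrow> (('s \<Rightarrow> real) \<Rightarrow> real) \<Rightarrow> bool" where
  "C1_on_orthant X g \<longleftrightarrow>
    continuous_on (orthant X) g \<and>
    (\<forall>n\<in>X.
      (\<forall>y \<in> orthant X. \<exists>D. has_partial_deriv g n y D \<and> D \<noteq> \<infinity> \<and> (y n > 0 \<longrightarrow> D \<noteq> -\<infinity>)) \<and>
      continuous_on (orthant X) (partial_deriv g n))"

text \<open>\<open>y L\<^sub>y \<nabla>g(y)\<close>, with the convention \<open>0 * \<infinity> = 0\<close> of the extended reals.\<close>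

definition drift ::
  "'s set \<Rightarrow> (('s \<Rightarrow> real) \<Rightarrow> 's \<Rightarrow> 's \<Rightarrow> real) \<Rightarrow> (('s \<Rightarrow> real) \<Rightarrow> real) \<Rightarrow> ('s \<Rightarrow> real) \<Rightarrow> ereal" where
  "drift X L g y = (\<Sum>n\<in>X. ereal (row_mult X y (L y) n) * partial_deriv g n y)"

text \<open>Boundedness from below is required on the phase space of the dynamics, the probability
  vectors; on the whole orthant it fails in general for the entropy-type functions of interest.\<close>

definition lyapunov_function ::
  "'s set \<Rightarrow> (('s \<Rightarrow> real) \<Rightarrow> 's \<Rightarrow> 's \<Rightarrow> real) \<Rightarrow> (('s \<Rightarrow> real) \<Rightarrow> real) \<Rightarrow> bool" where
  "lyapunov_function X L g \<longleftrightarrow>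
    C1_on_orthant X g \<and>
    bdd_below (g ` prob_vectors X) \<and>
    (\<forall>y \<in> prob_vectors X.
      drift X L g y \<le> 0 \<and>
      (drift X L g y = 0 \<longrightarrow> (\<forall>n\<in>X. row_mult X y (L y) n = 0)))"

end

theory Submission
  imports Defs
begin

text \<open>On the orthant, \<open>g(y) = \<Sum>\<^sub>n y\<^sub>n ln y\<^sub>n + H(y)\<close> with \<open>H\<close> continuously differentiable. The \<open>\<psi>\<^sub>k\<close> cancel
  the terms of \<open>\<nabla>H\<close> that come from the dependence of \<open>\<rho>\<^sup>n\<close> on \<open>y\<close>, and the derivative of \<open>ln Z\<close> is
  multiplied by \<open>\<Sum>\<^sub>n y\<^sub>n - 1\<close>, so that on probability vectors
  \<open>\<partial>g/\<partial>y\<^sub>n = 1 + ln (y\<^sub>n / \<nu>\<^bsub>\<rho>(y)\<^esub>(n))\<close>, just as if \<open>\<rho>\<close> were constant.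
  Since \<open>L\<^sub>y\<close> is reversible with respect to \<open>\<nu>\<^bsub>\<rho>(y)\<^esub>\<close>, the drift is minus the symmetric sum of
  \<open>\<nu>(m) L(m,n) (v\<^sub>m - v\<^sub>n) (ln v\<^sub>m - ln v\<^sub>n) / 2\<close> with \<open>v = y / \<nu>\<close>. If it vanishes, then
  \<open>v\<close> is constant along transitions and \<open>yL\<^sub>y = 0\<close>. At a boundary point, inflow into an empty state
  makes the drift \<open>-\<infinity>\<close>; without such inflow the support of \<open>y\<close> is closed and the same sum applies.\<close>

section \<open>Entropy plus a smooth function\<close>

text \<open>Unlike \<open>ln\<close>, whose value at 0 is a finite real, this takes the one-sided
  limit -\<infinity> there, so that one formula gives the partial derivatives up to the
  boundary.\<close>

definition ereal_ln :: "real \<Rightarrow> ereal" where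
  "ereal_ln x = (if x \<le> 0 then -\<infinity> else ereal (ln x))"

lemma ereal_ln_pos [simp]: "x > 0 \<Longrightarrow> ereal_ln x = ereal (ln x)"
  by (simp add: ereal_ln_def)

lemma ereal_ln_0 [simp]: "ereal_ln 0 = -\<infinity>"
  by (simp add: ereal_ln_def)

lemma ereal_ln_neq_PInf [simp]: "ereal_ln x \<noteq> \<infinity>"
  by (simp add: ereal_ln_def)

lemma continuous_on_ereal_ln: "continuous_on {0..} ereal_ln"
proof -
  have "(ereal_ln \<longlongrightarrow> ereal_ln x) (at x within {0..})" if "x \<ge> 0" for x
  proof (cases "x = 0")
    case True
    have "((ereal \<circ> ln) \<longlongrightarrow> -\<infinity>) (at_right (0::real))"
      using ln_at_0 by (simp only: ereal_tendsto_simps)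
    moreover have "eventually (\<lambda>t::real. ereal_ln t = (ereal \<circ> ln) t) (at_right 0)"
      by (auto simp: eventually_at_filter)
    ultimately have "(ereal_ln \<longlongrightarrow> -\<infinity>) (at_right 0)"
      by (rule tendsto_cong[THEN iffD2, rotated])
    then show ?thesis
      by (simp add: True at_within_Ici_at_right)
  next
    case False
    with that have x: "x > 0" by simp
    have "((\<lambda>t. ereal (ln t)) \<longlongrightarrow> ereal (ln x)) (at x)"
      using x by (intro tendsto_intros) auto
    moreover have "eventually (\<lambda>t. ereal_ln t = ereal (ln t)) (at x)"
      using eventually_at_in_open'[of "{0<..}" x] x by (auto elim!: eventually_mono)
    ultimately have "(ereal_ln \<longlongrightarrow> ereal (ln x)) (at x)"
      by (rule tendsto_cong[THEN iffD2, rotated])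
    then show ?thesis
      using x by (auto intro: tendsto_within_subset)
  qed
  then show ?thesis
    by (auto simp: continuous_on_def)
qed

lemma continuous_on_mult_ln: "continuous_on {0..} (\<lambda>x::real. x * ln x)"
proof -
  have "((\<lambda>x. x * ln x) \<longlongrightarrow> x * ln x) (at x within {0..})" if "x \<ge> 0" for x :: real
  proof (cases "x = 0")
    case True
    \<comment> \<open>With s = 1/x, the product x ln x is -(ln s)/s, and s tends to infinity as x
      tends to 0 from the right.\<close>
    have "((\<lambda>x::real. - (ln (inverse x) / inverse x)) \<longlongrightarrow> - 0) (at_right 0)"
      by (intro tendsto_minus filterlim_compose[OF ln_x_over_x_tendsto_0]
          filterlim_inverse_at_top_right)
    moreover have "eventually (\<lambda>x::real. - (ln (inverse x) / inverse x) = x * ln x) (at_right 0)"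
      by (auto simp: eventually_at_filter ln_inverse divide_inverse)
    ultimately have "((\<lambda>x::real. x * ln x) \<longlongrightarrow> - 0) (at_right 0)"
      by (rule tendsto_cong[THEN iffD1, rotated])
    then show ?thesis
      by (simp add: True at_within_Ici_at_right)
  next
    case False
    with that show ?thesis
      by (intro tendsto_intros) auto
  qed
  then show ?thesis
    by (auto simp: continuous_on_def)
qed

section \<open>Partial derivatives on the closed orthant\<close>

lemma has_partial_deriv_unique:
  assumes "has_partial_deriv g n y D" "has_partial_deriv g n y D'" "y n \<ge> 0"
  shows "D = D'"
proof (rule tendsto_unique)
  \<comment> \<open>Uniqueness of limits needs a nontrivial filter: [0, \<infinity>) contains a
    right neighbourhood of the nonnegative point \<open>y n\<close>.\<close>
  have "at (y n) within {y n..} \<le> at (y n) within {0..}"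
    using assms(3) by (intro at_le) auto
  then have "at_right (y n) \<le> at (y n) within {0..}"
    by (simp only: at_within_Ici_at_right)
  then show "at (y n) within {0..} \<noteq> bot"
    using le_bot trivial_limit_at_right_real by metis
qed (use assms in \<open>auto simp: has_partial_deriv_def\<close>)

lemma partial_deriv_eqI:
  "has_partial_deriv g n y D \<Longrightarrow> y n \<ge> 0 \<Longrightarrow> partial_deriv g n y = D"
  unfolding partial_deriv_def by (rule the_equality) (assumption, rule has_partial_deriv_unique)

lemma orthant_upd:
  assumes "y \<in> orthant X" "n \<in> X" "t \<ge> 0"
  shows "y(n := t) \<in> orthant X"
  using assms by (auto simp: PiE_iff extensional_def)

lemma orthant_nonneg: "y \<in> orthant X \<Longrightarrow> n \<in> X \<Longrightarrow> y n \<ge> 0"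
  by (auto simp: PiE_iff)

text \<open>Only one summand of the entropy sum moves, contributing 1 + ln (y n) to the slope.
  Writing 1 + d + ln (y n) as a single logarithm covers \<open>y n = 0\<close> too, where the slope
  is -\<infinity>.\<close>

lemma has_partial_deriv_entropy_plus:
  assumes X: "finite X" "n \<in> X" and y: "y \<in> orthant X"
    and g: "\<And>z. z \<in> orthant X \<Longrightarrow> g z = (\<Sum>m\<in>X. z m * ln (z m)) + H z"
    and H: "((\<lambda>t. H (y(n := t))) has_real_derivative d) (at (y n))"
  shows "has_partial_deriv g n y (ereal_ln (y n * exp (1 + d)))"
proof -
  have y0: "y n \<ge> 0"
    using y X(2) by (rule orthant_nonneg)
  let ?F = "at (y n) within {0..}"
  let ?q = "\<lambda>t. (H (y(n := t)) - H y) / (t - y n)"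
  let ?e = "\<lambda>t. (t * ln t - y n * ln (y n)) / (t - y n)"
  have q: "(?q \<longlongrightarrow> d) ?F"
    using H[THEN has_field_derivative_at_within, of "{0..}"]
    by (simp add: has_field_derivative_iff)
  have eq: "eventually (\<lambda>t. ereal ((g (y(n := t)) - g y) / (t - y n)) = ereal (?q t + ?e t)) ?F"
  proof -
    have "g (y(n := t)) - g y = (H (y(n := t)) - H y) + (t * ln t - y n * ln (y n))"
      if "t \<ge> 0" for t
    proof -
      have "(\<Sum>m\<in>X. (y(n := t)) m * ln ((y(n := t)) m)) = t * ln t + (\<Sum>m\<in>X - {n}. y m * ln (y m))"
        using X by (subst sum.remove[of _ n]) (auto intro!: sum.cong)
      moreover have "(\<Sum>m\<in>X. y m * ln (y m)) = y n * ln (y n) + (\<Sum>m\<in>X - {n}. y m * ln (y m))"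
        using X by (subst sum.remove[of _ n]) auto
      ultimately show ?thesis
        using g[OF y] g[OF orthant_upd[OF y X(2) that]] by simp
    qed
    then show ?thesis
      by (auto simp: eventually_at_filter add_divide_distrib)
  qed
  show ?thesis
  proof (cases "y n = 0")
    case True
    \<comment> \<open>At \<open>y n = 0\<close> the quotient of t ln t is ln t, which tends to
      -\<infinity> and dominates the convergent quotient of \<open>H\<close>.\<close>
    have "LIM t at_right 0. ?q t + ln t :> at_bot"
      using filterlim_tendsto_add_at_bot_iff[of ?q d "at_right 0" ln] q True ln_at_0
      by (simp add: at_within_Ici_at_right)
    then have "((ereal \<circ> (\<lambda>t. ?q t + ln t)) \<longlongrightarrow> -\<infinity>) ?F"
      unfolding True at_within_Ici_at_right by (simp only: ereal_tendsto_simps)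
    moreover have "eventually (\<lambda>t. ereal (?q t + ?e t) = (ereal \<circ> (\<lambda>t. ?q t + ln t)) t) ?F"
      by (auto simp: True eventually_at_filter)
    ultimately have "((\<lambda>t. ereal (?q t + ?e t)) \<longlongrightarrow> -\<infinity>) ?F"
      by (rule tendsto_cong[THEN iffD2, rotated])
    then have "((\<lambda>t. ereal ((g (y(n := t)) - g y) / (t - y n))) \<longlongrightarrow> -\<infinity>) ?F"
      by (rule tendsto_cong[OF eq, THEN iffD2])
    then show ?thesis
      by (simp add: has_partial_deriv_def True)
  next
    case False
    with y0 have pos: "y n > 0" by simp
    have "((\<lambda>t. t * ln t) has_real_derivative (1 + ln (y n))) (at (y n) within {0..})"
      using pos by (auto intro!: derivative_eq_intros)
    then have "((\<lambda>t. ?q t + ?e t) \<longlongrightarrow> d + (1 + ln (y n))) ?F"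
      using q by (intro tendsto_add) (simp_all add: has_field_derivative_iff)
    then have "((\<lambda>t. ereal (?q t + ?e t)) \<longlongrightarrow> ereal (d + (1 + ln (y n)))) ?F"
      by simp
    then have "((\<lambda>t. ereal ((g (y(n := t)) - g y) / (t - y n)))
                   \<longlongrightarrow> ereal (d + (1 + ln (y n)))) ?F"
      by (rule tendsto_cong[OF eq, THEN iffD2])
    then show ?thesis
      using pos by (simp add: has_partial_deriv_def ln_mult algebra_simps)
  qed
qed

text \<open>Each partial derivative is \<open>ereal_ln\<close> composed with a continuous
  nonnegative real function, hence continuous into the extended reals.\<close>

lemma C1_on_orthant_entropy_plus:
  assumes X: "finite X"
    and g: "\<And>y. y \<in> orthant X \<Longrightarrow> g y = (\<Sum>m\<in>X. y m * ln (y m)) + H y"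
    and H: "continuous_on (orthant X) H"
    and dH: "\<And>n y. n \<in> X \<Longrightarrow> y \<in> orthant X \<Longrightarrow>
      ((\<lambda>t. H (y(n := t))) has_real_derivative h n y) (at (y n))"
    and h: "\<And>n. n \<in> X \<Longrightarrow> continuous_on (orthant X) (h n)"
  shows "C1_on_orthant X g"
  unfolding C1_on_orthant_def
proof (intro conjI ballI)
  have coord: "continuous_on (orthant X) (\<lambda>y. y n)" for n
    by (rule continuous_on_product_coordinates[THEN continuous_on_subset]) simp
  have "continuous_on (orthant X) (\<lambda>y. y n * ln (y n))" if "n \<in> X" for n
    by (rule continuous_on_compose2[OF continuous_on_mult_ln coord])
       (auto simp: orthant_nonneg that)
  then have "continuous_on (orthant X) (\<lambda>y. (\<Sum>m\<in>X. y m * ln (y m)) + H y)"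
    by (intro continuous_on_add continuous_on_sum H)
  then show "continuous_on (orthant X) g"
    by (simp add: g cong: continuous_on_cong)
  fix n assume n: "n \<in> X"
  have D: "has_partial_deriv g n y (ereal_ln (y n * exp (1 + h n y)))" if "y \<in> orthant X" for y
    by (rule has_partial_deriv_entropy_plus[where H = H, OF X n that g dH[OF n that]])
  have "continuous_on (orthant X) (\<lambda>y. ereal_ln (y n * exp (1 + h n y)))"
  proof (rule continuous_on_compose2[OF continuous_on_ereal_ln])
    show "continuous_on (orthant X) (\<lambda>y. y n * exp (1 + h n y))"
      by (intro continuous_on_mult coord continuous_on_exp continuous_on_add continuous_on_const h n)
    show "(\<lambda>y. y n * exp (1 + h n y)) ` orthant X \<subseteq> {0..}"
      using n by (auto simp: orthant_nonneg)
  qed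
  moreover have "ereal_ln (y n * exp (1 + h n y)) = partial_deriv g n y" if "y \<in> orthant X" for y
    using partial_deriv_eqI[OF D[OF that] orthant_nonneg[OF that n]] by simp
  ultimately show "continuous_on (orthant X) (partial_deriv g n)"
    by (rule continuous_on_eq)
  fix y assume y: "y \<in> orthant X"
  show "\<exists>D. has_partial_deriv g n y D \<and> D \<noteq> \<infinity> \<and> (y n > 0 \<longrightarrow> D \<noteq> -\<infinity>)"
    using D[OF y] by (intro exI[of _ "ereal_ln (y n * exp (1 + h n y))"]) simp
qed

section \<open>Boundedness from below on the probability vectors\<close>

lemma compact_PiE:
  fixes S :: "'i \<Rightarrow> 'a::topological_space set"
  assumes "\<And>i. i \<in> I \<Longrightarrow> compact (S i)"
  shows "compact (PiE I S)"
proof -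
  \<comment> \<open>Being \<open>undefined\<close> outside \<open>I\<close> amounts to a singleton
    factor there, so Tychonoff's theorem for the full product applies.\<close>
  have "PiE I S = PiE UNIV (\<lambda>i. if i \<in> I then S i else {undefined})"
    by (fastforce simp: PiE_iff extensional_def split: if_splits)
  moreover have "compactin (product_topology (\<lambda>i. euclidean) UNIV)
      (PiE UNIV (\<lambda>i. if i \<in> I then S i else {undefined}))"
    using assms by (simp add: compactin_PiE)
  ultimately show ?thesis
    by (simp add: euclidean_product_topology)
qed

text \<open>Probability vectors lie in the cube with sides [0,1], which is compact.\<close>

lemma bdd_below_prob_vectors:
  fixes g :: "('s \<Rightarrow> real) \<Rightarrow> real"
  assumes X: "finite X" and g: "continuous_on (orthant X) g"
  shows "bdd_below (g ` prob_vectors X)"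
proof -
  let ?K = "X \<rightarrow>\<^sub>E {0..1::real}"
  have "?K \<subseteq> orthant X"
    by (rule PiE_mono) auto
  then have "compact (g ` ?K)"
    by (intro compact_continuous_image compact_PiE continuous_on_subset[OF g]) auto
  then have "bdd_below (g ` ?K)"
    by (intro bounded_imp_bdd_below[OF compact_imp_bounded])
  moreover have "prob_vectors X \<subseteq> ?K"
  proof
    fix y assume "y \<in> prob_vectors X"
    then have y: "y \<in> orthant X" "(\<Sum>n\<in>X. y n) = 1"
      by (auto simp: prob_vectors_def)
    then have "y n \<le> 1" if "n \<in> X" for n
      using member_le_sum[of n X y] X that orthant_nonneg[OF y(1)] by auto
    with y(1) show "y \<in> ?K"
      by (auto simp: PiE_iff)
  qed
  ultimately show ?thesis
    by (meson bdd_below_mono image_mono)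
qed

section \<open>Drift of a reversible generator\<close>

text \<open>Discrete integration by parts. In the expanded right-hand side, terms where
  \<open>v\<close> and \<open>u\<close> share an index vanish because rows, and by symmetry columns,
  sum to 0; the two mixed terms coincide by symmetry.\<close>

lemma reversible_sum_symmetrise:
  fixes Q :: "'s \<Rightarrow> 's \<Rightarrow> real"
  assumes sym: "\<And>m n. m \<in> X \<Longrightarrow> n \<in> X \<Longrightarrow> Q m n = Q n m"
    and rows: "\<And>m. m \<in> X \<Longrightarrow> (\<Sum>n\<in>X. Q m n) = 0"
  shows "2 * (\<Sum>m\<in>X. \<Sum>n\<in>X. Q m n * v m * u n) = (\<Sum>m\<in>X. \<Sum>n\<in>X. Q m n * ((v m - v n) * (u n - u m)))"
proof -
  have diag: "(\<Sum>m\<in>X. \<Sum>n\<in>X. Q m n * w m) = 0" for w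
    by (simp add: sum_distrib_right[symmetric] rows)
  have diag': "(\<Sum>m\<in>X. \<Sum>n\<in>X. Q m n * w n) = 0" for w
    by (subst sum.swap) (use diag[of w] in \<open>simp add: sym cong: sum.cong\<close>)
  have swap: "(\<Sum>m\<in>X. \<Sum>n\<in>X. Q m n * (v n * u m)) = (\<Sum>m\<in>X. \<Sum>n\<in>X. Q m n * (v m * u n))"
    by (subst sum.swap) (simp add: sym cong: sum.cong)
  have "(\<Sum>m\<in>X. \<Sum>n\<in>X. Q m n * ((v m - v n) * (u n - u m))) =
     (\<Sum>m\<in>X. \<Sum>n\<in>X. Q m n * (v m * u n)) - (\<Sum>m\<in>X. \<Sum>n\<in>X. Q m n * (v m * u m))
     - (\<Sum>m\<in>X. \<Sum>n\<in>X. Q m n * (v n * u n)) + (\<Sum>m\<in>X. \<Sum>n\<in>X. Q m n * (v n * u m))"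
    by (simp add: sum_subtractf[symmetric] sum.distrib[symmetric] algebra_simps)
  then show ?thesis
    using diag[of "\<lambda>m. v m * u m"] diag'[of "\<lambda>m. v m * u m"] swap by (simp add: mult.assoc)
qed

lemma sum_nonpos_eq_0_iff:
  fixes f :: "'a \<Rightarrow> real"
  assumes "finite A" "\<And>x. x \<in> A \<Longrightarrow> f x \<le> 0"
  shows "sum f A = 0 \<longleftrightarrow> (\<forall>x\<in>A. f x = 0)"
  using sum_nonneg_eq_0_iff[of A "\<lambda>x. - f x"] assms by (simp add: sum_negf)

lemma diff_mult_ln_diff_nonpos:
  fixes a b :: real
  assumes "a > 0" "b > 0"
  shows "(a - b) * (ln b - ln a) \<le> 0" and "(a - b) * (ln b - ln a) = 0 \<Longrightarrow> a = b"
  using assms by (auto simp: mult_le_0_iff)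

text \<open>The reversible measure \<open>\<nu>\<close> need not be normalised: its scale absorbs additive constants in the
  partial derivatives.\<close>

lemma drift_reversible:
  assumes X: "finite X" and y: "y \<in> orthant X"
    and \<nu>: "\<And>n. n \<in> X \<Longrightarrow> \<nu> n > 0"
    and rates: "\<And>m n. m \<in> X \<Longrightarrow> n \<in> X \<Longrightarrow> m \<noteq> n \<Longrightarrow> L y m n \<ge> 0"
    and rows: "\<And>m. m \<in> X \<Longrightarrow> (\<Sum>n\<in>X. L y m n) = 0"
    and balance: "\<And>m n. m \<in> X \<Longrightarrow> n \<in> X \<Longrightarrow> m \<noteq> n \<Longrightarrow> \<nu> m * L y m n = \<nu> n * L y n m"
    and D: "\<And>n. n \<in> X \<Longrightarrow> partial_deriv g n y = ereal_ln (y n / \<nu> n)"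
  shows "drift X L g y \<le> 0 \<and> (drift X L g y = 0 \<longrightarrow> (\<forall>n\<in>X. row_mult X y (L y) n = 0))"
proof -
  have y0: "y n \<ge> 0" if "n \<in> X" for n
    using y that by (rule orthant_nonneg)
  \<comment> \<open>For \<open>m = n\<close> the rate may be negative, but then the factor
    \<open>y n\<close> is 0.\<close>
  have inflow: "y m * L y m n \<ge> 0" if "m \<in> X" "n \<in> X" "y n = 0" for m n
    using that y0 rates by (cases "m = n") auto
  let ?r = "row_mult X y (L y)"
  have r0: "?r n \<ge> 0" if "n \<in> X" "y n = 0" for n
    unfolding row_mult_def using that inflow by (intro sum_nonneg) auto
  show ?thesis
  proof (cases "\<exists>n\<in>X. y n = 0 \<and> ?r n \<noteq> 0")
    case True
    then obtain n where n: "n \<in> X" "y n = 0" "?r n \<noteq> 0"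
      by blast
    with r0 have "?r n > 0"
      by force
    then have minf: "ereal (?r n) * partial_deriv g n y = -\<infinity>"
      using n by (simp add: D)
    \<comment> \<open>A partial derivative is infinite only at an empty state, where it is
      -\<infinity> and meets a nonnegative factor. So no term is +\<infinity>, and the one term
      -\<infinity> decides the sum.\<close>
    have "ereal (?r m) * partial_deriv g m y \<noteq> \<infinity>" if "m \<in> X" for m
      using that r0[OF that] y0[OF that] \<nu>[OF that]
      by (cases "y m = 0"; cases "?r m = 0") (auto simp: D less_le)
    then have "(\<Sum>m\<in>X - {n}. ereal (?r m) * partial_deriv g m y) \<noteq> \<infinity>"
      by (auto simp: sum_Pinfty)
    then have "drift X L g y = -\<infinity>"
      unfolding drift_def sum.remove[OF X n(1)] minf by simp
    then show ?thesis
      by simp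
  next
    case False
    then have bd: "?r n = 0" if "n \<in> X" "y n = 0" for n
      using that by blast
    \<comment> \<open>\<open>v\<close> is the density of \<open>y\<close> with respect to
      \<open>\<nu>\<close>; detailed balance is the symmetry of the flow matrix
      \<open>Q\<close>.\<close>
    define v where "v n = y n / \<nu> n" for n
    define Q where "Q m n = \<nu> m * L y m n" for m n
    have Qv: "Q m n * v m = y m * L y m n" if "m \<in> X" for m n
      using \<nu>[OF that] by (simp add: Q_def v_def)
    have sym: "Q m n = Q n m" if "m \<in> X" "n \<in> X" for m n
      using balance[OF that] by (cases "m = n") (auto simp: Q_def)
    have Qrows: "(\<Sum>n\<in>X. Q m n) = 0" if "m \<in> X" for m
      using rows[OF that] by (simp add: Q_def sum_distrib_left[symmetric])
    have Q0: "Q m n \<ge> 0" if "m \<in> X" "n \<in> X" "m \<noteq> n" for m n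
      using rates[OF that] \<nu>[OF that(1)] by (simp add: Q_def)
    have vpos: "v n > 0" if "n \<in> X" "y n \<noteq> 0" for n
      using \<nu>[OF that(1)] y0[OF that(1)] that by (auto simp: v_def)
    have r: "?r n = (\<Sum>m\<in>X. Q m n * v m)" for n
      unfolding row_mult_def by (simp add: Qv)
    \<comment> \<open>At an empty state both sides are 0: \<open>?r n\<close> is 0 there, and 0 *
      (-\<infinity>) = 0.\<close>
    have summand: "ereal (?r n) * partial_deriv g n y = ereal (?r n * ln (v n))" if "n \<in> X" for n
      using that bd[OF that] vpos[OF that] by (cases "y n = 0") (auto simp: D v_def)
    have "drift X L g y = ereal (\<Sum>n\<in>X. ?r n * ln (v n))"
      unfolding drift_def by (simp add: summand)
    also have "(\<Sum>n\<in>X. ?r n * ln (v n)) = (\<Sum>m\<in>X. \<Sum>n\<in>X. Q m n * v m * ln (v n))"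
      unfolding r sum_distrib_right by (rule sum.swap)
    finally have drift: "drift X L g y = ereal (\<Sum>m\<in>X. \<Sum>n\<in>X. Q m n * v m * ln (v n))" .
    \<comment> \<open>The inflow into an empty state is a vanishing sum of nonnegative terms, so no
      occupied state leads into it.\<close>
    have closed: "Q m n = 0" if "m \<in> X" "n \<in> X" "y m \<noteq> 0" "y n = 0" for m n
    proof -
      have "\<forall>m\<in>X. y m * L y m n = 0"
        using bd[OF that(2,4)] inflow[OF _ that(2,4)] X
        unfolding row_mult_def by (subst (asm) sum_nonneg_eq_0_iff) auto
      with that show ?thesis
        by (auto simp: Q_def)
    qed
    let ?T = "\<lambda>m n. Q m n * ((v m - v n) * (ln (v n) - ln (v m)))"
    have T: "?T m n \<le> 0 \<and> (?T m n = 0 \<longrightarrow> Q m n * v m = Q m n * v n)"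
      if mn: "m \<in> X" "n \<in> X" for m n
    proof (cases "m = n")
      case False
      show ?thesis
      proof (cases "y m = 0 \<or> y n = 0")
        case True
        \<comment> \<open>If exactly one state is empty, \<open>closed\<close> and symmetry give
          \<open>Q m n = 0\<close>; if both are, both densities are 0.\<close>
        then have "Q m n = 0 \<or> v m = v n"
          using closed mn sym unfolding v_def by (metis div_0)
        then show ?thesis
          by auto
      next
        case pos: False
        with vpos mn have "v m > 0" "v n > 0"
          by auto
        then show ?thesis
          using diff_mult_ln_diff_nonpos[of "v m" "v n"] Q0[OF mn False]
          by (auto intro: mult_nonneg_nonpos)
      qed
    qed simp
    have sum2: "2 * (\<Sum>m\<in>X. \<Sum>n\<in>X. Q m n * v m * ln (v n)) = (\<Sum>m\<in>X. \<Sum>n\<in>X. ?T m n)"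
      using sym Qrows by (rule reversible_sum_symmetrise)
    have inner: "(\<Sum>n\<in>X. ?T m n) \<le> 0" if "m \<in> X" for m
      using T that by (intro sum_nonpos) auto
    then have "(\<Sum>m\<in>X. \<Sum>n\<in>X. ?T m n) \<le> 0"
      by (rule sum_nonpos)
    moreover have "?r n = 0" if zero: "(\<Sum>m\<in>X. \<Sum>n\<in>X. ?T m n) = 0" and n: "n \<in> X" for n
    proof -
      have "(\<Sum>n\<in>X. ?T m n) = 0" if "m \<in> X" for m
        using zero that sum_nonpos_eq_0_iff[of X "\<lambda>m. \<Sum>n\<in>X. ?T m n", OF X inner] by blast
      then have "?T m n = 0" if "m \<in> X" for m
        using T that n sum_nonpos_eq_0_iff[OF X, of "?T m"] by blast
      with T n have "Q m n * v m = Q m n * v n" if "m \<in> X" for m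
        using that by blast
      \<comment> \<open>Replacing \<open>v m\<close> by \<open>v n\<close> turns the flow into
        \<open>n\<close> into \<open>v n\<close> times a row sum of \<open>Q\<close>.\<close>
      then have "?r n = (\<Sum>m\<in>X. Q n m * v n)"
        unfolding r using n sym by (intro sum.cong) auto
      also have "\<dots> = 0"
        using Qrows[OF n] by (simp add: sum_distrib_right[symmetric])
      finally show ?thesis .
    qed
    ultimately show ?thesis
      using sum2 by (auto simp: drift)
  qed
qed

section \<open>The multiclass loss queue\<close>

lemma finite_states:
  assumes "\<And>k. A $ k \<ge> 1"
  shows "finite (states C A)"
proof -
  have "n $ k \<le> C" if "n \<in> states C A" for n k
  proof -
    have "n $ k \<le> n $ k * A $ k"
      using assms[of k] by simp
    also have "\<dots> \<le> (\<Sum>k\<in>UNIV. n $ k * A $ k)"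
      by (rule member_le_sum) auto
    finally show ?thesis
      using that by (simp add: states_def)
  qed
  then have "vec_nth ` states C A \<subseteq> UNIV \<rightarrow>\<^sub>E {..C}"
    by auto
  then have "finite (vec_nth ` states C A)"
    by (rule finite_subset) (simp add: finite_PiE)
  then show ?thesis
    by (rule finite_imageD) (simp add: inj_on_def vec_nth_inject)
qed

lemma zero_in_states: "0 \<in> states C A"
  by (simp add: states_def)

lemma stationary_weight_pos:
  "(\<And>k. \<rho> $ k > 0) \<Longrightarrow> stationary_weight \<rho> n > 0"
  by (auto simp: stationary_weight_def intro!: divide_pos_pos prod_pos)

lemma partition_function_pos:
  assumes "finite X" "X \<noteq> {}" "\<And>k. \<rho> $ k > 0"
  shows "partition_function X \<rho> > 0"
  unfolding partition_function_def using assms by (intro sum_pos stationary_weight_pos)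

text \<open>One more customer of class \<open>k\<close> adds a factor \<open>\<rho> $ k\<close> to
  the numerator and \<open>n $ k + 1\<close> to the factorial; detailed balance compares this ratio
  with the rates.\<close>

lemma stationary_weight_add_axis:
  "stationary_weight \<rho> (n + axis k 1) = stationary_weight \<rho> n * (\<rho> $ k / real (n $ k + 1))"
proof -
  have "(\<Prod>j\<in>UNIV. \<rho> $ j ^ ((n + axis k 1) $ j)) = (\<Prod>j\<in>UNIV. \<rho> $ j ^ (n $ j)) * \<rho> $ k"
    by (simp add: axis_def prod.remove[of _ k] mult_ac)
  moreover have "(\<Prod>j\<in>UNIV. fact ((n + axis k 1) $ j)) =
      (\<Prod>j\<in>UNIV. fact (n $ j)) * (real (n $ k + 1))"
    by (simp add: axis_def prod.remove[of _ k] mult_ac)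
  ultimately show ?thesis
    by (simp add: stationary_weight_def)
qed

section \<open>Transitions of the queue and detailed balance\<close>

lemma add_axis_diff: "n + axis k 1 - axis k 1 = (n :: nat ^ 'k)"
  by (simp add: vec_eq_iff)

lemma diff_axis_add: "n $ k \<ge> 1 \<Longrightarrow> n - axis k 1 + axis k 1 = (n :: nat ^ 'k)"
  by (auto simp: vec_eq_iff axis_def)

text \<open>Both directions of a transition are evaluated together, as detailed balance needs. The
  downward rate carries the count of the upper state, one more than that of the lower.\<close>

lemma queue_generator_transition_cases:
  assumes L: "queue_generator C A a b L" and n: "n \<in> states C A" and m: "m \<in> states C A" "m \<noteq> n"
  obtains (arrival) k where "m = n + axis k 1" "L n m = a $ k" "L m n = b $ k * real (n $ k + 1)"
  | (departure) k where "n = m + axis k 1" "L m n = a $ k" "L n m = b $ k * real (m $ k + 1)"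
  | (none) "L n m = 0" "L m n = 0"
proof -
  note gen = bspec[OF L[unfolded queue_generator_def]]
  have up: "L i (i + axis k 1) = a $ k"
    and down: "L (i + axis k 1) i = b $ k * real (i $ k + 1)"
    if i: "i \<in> states C A" and j: "i + axis k 1 \<in> states C A" for i k
  proof -
    show "L i (i + axis k 1) = a $ k"
      using conjunct1[OF gen[OF i]] j by blast
    have "(i + axis k 1) $ k \<ge> 1 \<longrightarrow>
        L (i + axis k 1) (i + axis k 1 - axis k 1) = b $ k * real ((i + axis k 1) $ k)"
      using conjunct1[OF conjunct2[OF gen[OF j]]] by (rule spec)
    then show "L (i + axis k 1) i = b $ k * real (i $ k + 1)"
      by (simp add: add_axis_diff axis_def)
  qed
  have zero: "L i j = 0"
    if i: "i \<in> states C A" and j: "j \<in> states C A" "i \<noteq> j"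
      and no: "\<nexists>k. j = i + axis k 1" "\<nexists>k. i = j + axis k 1" for i j
  proof -
    \<comment> \<open>Subtraction of naturals truncates, but with \<open>i $ k \<ge> 1\<close> the
      equation \<open>j = i - axis k 1\<close> would give \<open>i = j + axis k 1\<close>, which is
      excluded.\<close>
    have "j \<noteq> i - axis k 1" if "i $ k \<ge> 1" for k
      using no(2) diff_axis_add[OF that] by metis
    with no(1) j(2) show ?thesis
      by (intro bspec[OF conjunct1[OF conjunct2[OF conjunct2[OF gen[OF i]]]] j(1), THEN mp]) simp
  qed
  consider k where "m = n + axis k 1" | k where "n = m + axis k 1"
    | "\<nexists>k. m = n + axis k 1" "\<nexists>k. n = m + axis k 1"
    by blast
  then show thesis
  proof cases
    case (1 k)
    with n m(1) show thesis
      using arrival[OF 1] up[of n k] down[of n k] by simp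
  next
    case (2 k)
    with n m(1) show thesis
      using departure[OF 2] up[of m k] down[of m k] by simp
  next
    case 3
    show thesis
      by (rule none; rule zero) (use n m 3 in auto)
  qed
qed

text \<open>Since \<open>a $ k = \<rho> $ k * b $ k\<close>, the weight ratio of two neighbouring
  states is exactly the ratio of the upward rate to the downward rate.\<close>

lemma queue_generator_balance:
  assumes L: "queue_generator C A a b L" and ab: "\<And>k. b $ k > 0" "\<And>k. a $ k / b $ k = \<rho> $ k"
    and n: "n \<in> states C A" and m: "m \<in> states C A" "m \<noteq> n"
  shows "stationary_weight \<rho> n * L n m = stationary_weight \<rho> m * L m n"
proof -
  have a: "a $ k = \<rho> $ k * b $ k" for k
    using ab[of k] by (simp add: field_simps)
  from L n m show ?thesis
    by (cases rule: queue_generator_transition_cases)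
       (simp_all add: stationary_weight_add_axis a del: of_nat_Suc of_nat_add One_nat_def)
qed

lemma queue_generator_nonneg:
  assumes L: "queue_generator C A a b L" and ab: "\<And>k. a $ k > 0" "\<And>k. b $ k > 0"
    and n: "n \<in> states C A" and m: "m \<in> states C A" "m \<noteq> n"
  shows "L n m \<ge> 0"
  using L n m by (cases rule: queue_generator_transition_cases) (simp_all add: ab less_imp_le)

section \<open>The entropy functional\<close>

text \<open>Logarithmic differentiation of a product of powers; the factorials are constant.\<close>

lemma has_real_derivative_stationary_weight:
  fixes r :: "'k::finite \<Rightarrow> real \<Rightarrow> real"
  assumes "\<And>k. (r k has_real_derivative r' k) (at x)" and "\<And>k. r k x > 0"
  shows "((\<lambda>t. stationary_weight (\<chi> k. r k t) m) has_real_derivative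
    stationary_weight (\<chi> k. r k x) m * (\<Sum>k\<in>UNIV. real (m $ k) * r' k / r k x)) (at x)"
proof -
  have nz: "r k x \<noteq> 0" for k
    using assms(2)[of k] by simp
  have "((\<lambda>t. \<Prod>k\<in>UNIV. r k t ^ (m $ k)) has_real_derivative
     (\<Prod>k\<in>UNIV. r k x ^ (m $ k)) *
     (\<Sum>k\<in>UNIV. (real (m $ k) * r k x ^ (m $ k - 1) * r' k) / r k x ^ (m $ k))) (at x)"
    using assms(1) nz by (intro has_field_derivative_prod') (auto intro!: derivative_eq_intros)
  \<comment> \<open>The exponent \<open>m $ k - 1\<close> truncates when \<open>m $ k = 0\<close>;
    the factor \<open>real (m $ k)\<close> then makes both sides 0.\<close>
  moreover have "(real (m $ k) * r k x ^ (m $ k - 1) * r' k) / r k x ^ (m $ k) =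
      real (m $ k) * r' k / r k x" for k
    using nz[of k] by (cases "m $ k") (simp_all add: field_simps)
  ultimately have "((\<lambda>t. \<Prod>k\<in>UNIV. r k t ^ (m $ k)) has_real_derivative
     (\<Prod>k\<in>UNIV. r k x ^ (m $ k)) * (\<Sum>k\<in>UNIV. real (m $ k) * r' k / r k x)) (at x)"
    by simp
  from DERIV_cdivide[OF this] show ?thesis
    by (simp add: stationary_weight_def)
qed

lemma sum_mult_upd:
  fixes y :: "'s \<Rightarrow> real"
  assumes "finite X" "n \<in> X"
  shows "(\<Sum>m\<in>X. c m * (y(n := t)) m) = (\<Sum>m\<in>X. c m * y m) + c n * (t - y n)"
proof -
  have "(\<Sum>m\<in>X. c m * (y(n := t)) m) = c n * t + (\<Sum>m\<in>X - {n}. c m * y m)"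
    unfolding sum.remove[OF assms] by (auto intro!: sum.cong)
  moreover have "(\<Sum>m\<in>X. c m * y m) = c n * y n + (\<Sum>m\<in>X - {n}. c m * y m)"
    by (rule sum.remove[OF assms])
  ultimately show ?thesis
    by (simp add: right_diff_distrib)
qed

lemma ln_stationary_weight:
  assumes \<rho>: "\<And>k. \<rho> $ k > 0"
  shows "ln (stationary_weight \<rho> n) =
    (\<Sum>k\<in>UNIV. real (n $ k) * ln (\<rho> $ k)) - ln (\<Prod>k\<in>UNIV. fact (n $ k))"
proof -
  have nz: "\<rho> $ k ^ (n $ k) \<noteq> 0" for k
    using \<rho>[of k] by simp
  have "ln (stationary_weight \<rho> n) = ln (\<Prod>k\<in>UNIV. \<rho> $ k ^ (n $ k)) - ln (\<Prod>k\<in>UNIV. fact (n $ k))"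
    unfolding stationary_weight_def using \<rho> by (intro ln_divide_pos prod_pos) auto
  also have "ln (\<Prod>k\<in>UNIV. \<rho> $ k ^ (n $ k)) = (\<Sum>k\<in>UNIV. ln (\<rho> $ k ^ (n $ k)))"
    by (rule ln_prod[OF finite nz])
  also have "\<dots> = (\<Sum>k\<in>UNIV. real (n $ k) * ln (\<rho> $ k))"
    by (rule sum.cong) (simp_all add: ln_realpow \<rho>)
  finally show ?thesis .
qed

text \<open>The total mass stays as a factor of ln Z instead of being set to 1, since partial
  derivatives leave the set of probability vectors.\<close>

lemma relative_entropy_reversible_dist:
  assumes X: "finite X" "X \<noteq> {}" and y: "y \<in> orthant X" and \<rho>: "\<And>k. \<rho> $ k > 0"
  shows "relative_entropy X y (reversible_dist X \<rho>) =
    (\<Sum>n\<in>X. y n * ln (y n)) + (\<Sum>n\<in>X. y n * ln (\<Prod>k\<in>UNIV. fact (n $ k)))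
    - (\<Sum>k\<in>UNIV. mean X k y * ln (\<rho> $ k)) + (\<Sum>n\<in>X. y n) * ln (partition_function X \<rho>)"
proof -
  have Z: "partition_function X \<rho> > 0"
    using X \<rho> by (rule partition_function_pos)
  have "y n * ln (y n / reversible_dist X \<rho> n) = y n * ln (y n)
      + y n * ln (\<Prod>k\<in>UNIV. fact (n $ k))
      - (\<Sum>k\<in>UNIV. real (n $ k) * y n * ln (\<rho> $ k)) + y n * ln (partition_function X \<rho>)"
    if n: "n \<in> X" for n
  proof (cases "y n = 0")
    case False
    with orthant_nonneg[OF y n] have yn: "y n > 0"
      by simp
    have w: "stationary_weight \<rho> n > 0"
      using \<rho> by (rule stationary_weight_pos)
    have "ln (y n / reversible_dist X \<rho> n) =
        ln (y n) - ln (stationary_weight \<rho> n) + ln (partition_function X \<rho>)"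
      using yn w Z by (simp add: reversible_dist_def ln_divide_pos ln_mult_pos)
    then have "y n * ln (y n / reversible_dist X \<rho> n) = y n * (ln (y n)
        - ((\<Sum>k\<in>UNIV. real (n $ k) * ln (\<rho> $ k)) - ln (\<Prod>k\<in>UNIV. fact (n $ k)))
        + ln (partition_function X \<rho>))"
      by (simp only: ln_stationary_weight[OF \<rho>])
    then show ?thesis
      by (simp add: sum_distrib_left algebra_simps)
  qed simp
  moreover have "(\<Sum>n\<in>X. \<Sum>k\<in>UNIV. real (n $ k) * y n * ln (\<rho> $ k)) =
      (\<Sum>k\<in>UNIV. mean X k y * ln (\<rho> $ k))"
    by (subst sum.swap) (simp add: mean_def sum_distrib_right)
  ultimately show ?thesis
    by (simp add: relative_entropy_def sum.distrib sum_subtractf sum_distrib_right)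
qed

text \<open>Dividing the reversible distribution by \<open>exp 1\<close> absorbs the constant of the
  partial derivative: 1 + ln (y / \<nu>) = ln (y / (\<nu> / e)).\<close>

lemma queue_entropy_C1:
  fixes X :: "(nat ^ 'k) set"
    and \<phi> \<psi> :: "'k \<Rightarrow> real \<Rightarrow> real"
  defines "\<rho> \<equiv> \<lambda>y. \<chi> k. \<phi> k (mean X k y)"
  defines "g \<equiv> \<lambda>y. relative_entropy X y (reversible_dist X (\<rho> y))
                 - ln (partition_function X (\<rho> y)) + (\<Sum>k\<in>UNIV. \<psi> k (mean X k y))"
  assumes X: "finite X" "X \<noteq> {}"
    and \<phi>: "\<And>k x. \<phi> k x > 0" "\<And>k. \<phi> k C1_differentiable_on UNIV"
    and \<psi>: "\<And>k x. (\<psi> k has_real_derivative x * deriv (\<phi> k) x / \<phi> k x) (at x)"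
  shows "C1_on_orthant X g"
    and "\<And>n y. n \<in> X \<Longrightarrow> y \<in> prob_vectors X \<Longrightarrow>
      partial_deriv g n y = ereal_ln (y n / (reversible_dist X (\<rho> y) n / exp 1))"
proof -
  have \<phi>': "(\<phi> k has_real_derivative deriv (\<phi> k) x) (at x)"
    and \<phi>'_cont: "continuous_on UNIV (deriv (\<phi> k))" for k x
  proof -
    obtain D where D: "\<And>x. (\<phi> k has_real_derivative D x) (at x)" "continuous_on UNIV D"
      using \<phi>(2)[of k]
      by (auto simp: C1_differentiable_on_def has_real_derivative_iff_has_vector_derivative)
    then have "deriv (\<phi> k) = D"
      by (intro ext DERIV_imp_deriv)
    with D show "(\<phi> k has_real_derivative deriv (\<phi> k) x) (at x)"
      and "continuous_on UNIV (deriv (\<phi> k))"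
      by auto
  qed
  have \<phi>_nz: "\<phi> k x \<noteq> 0" for k x
    using \<phi>(1)[of k x] by simp
  have \<rho>: "\<rho> y $ k > 0" for y k
    by (simp add: \<rho>_def \<phi>)
  have Z: "partition_function X (\<rho> y) > 0" for y
    using X \<rho> by (rule partition_function_pos)
  then have Z_nz: "partition_function X (\<rho> y) \<noteq> 0" for y
    by (metis less_irrefl)
  define lf :: "nat ^ 'k \<Rightarrow> real" where "lf n = ln (\<Prod>k\<in>UNIV. fact (n $ k))" for n
  \<comment> \<open>What remains of \<open>g\<close> without the entropy sum. The two ln Z terms
    merge into one with factor total mass minus 1; the form \<open>1 * y m\<close> makes the mass an
    instance of \<open>lin\<close>.\<close>
  define H where "H y = (\<Sum>m\<in>X. lf m * y m)
      + (\<Sum>k\<in>UNIV. \<psi> k (mean X k y) - mean X k y * ln (\<phi> k (mean X k y)))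
      + ((\<Sum>m\<in>X. 1 * y m) - 1) * ln (partition_function X (\<rho> y))" for y
  \<comment> \<open>The derivative of the partition function in coordinate \<open>n\<close>, by the
    chain rule: mean \<open>k\<close> has slope \<open>n $ k\<close> in that coordinate.\<close>
  define dZ where "dZ n y = (\<Sum>m\<in>X. stationary_weight (\<rho> y) m *
      (\<Sum>k\<in>UNIV. real (m $ k) * (deriv (\<phi> k) (mean X k y) * real (n $ k)) / \<phi> k (mean X k y)))"
    for n :: "nat ^ 'k" and y
  define h where "h n y = lf n - (\<Sum>k\<in>UNIV. real (n $ k) * ln (\<phi> k (mean X k y)))
      + (ln (partition_function X (\<rho> y))
         + ((\<Sum>m\<in>X. 1 * y m) - 1) * (dZ n y / partition_function X (\<rho> y)))"
    for n :: "nat ^ 'k" and y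

  have g: "g y = (\<Sum>m\<in>X. y m * ln (y m)) + H y" if "y \<in> orthant X" for y
    using relative_entropy_reversible_dist[OF X that \<rho>, of y]
    by (simp add: g_def H_def lf_def sum_subtractf algebra_simps) (simp add: \<rho>_def)

  have dH: "((\<lambda>t. H (y(n := t))) has_real_derivative h n y) (at (y n))" if n: "n \<in> X" for n y
  proof -
    have lin: "((\<lambda>t. \<Sum>m\<in>X. c m * (y(n := t)) m) has_real_derivative c n) (at (y n))" for c
      unfolding sum_mult_upd[OF X(1) n] by (auto intro!: derivative_eq_intros)
    have mean': "((\<lambda>t. mean X k (y(n := t))) has_real_derivative real (n $ k)) (at (y n))" for k
      unfolding mean_def by (rule lin)
    have \<phi>m: "((\<lambda>t. \<phi> k (mean X k (y(n := t)))) has_real_derivative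
        deriv (\<phi> k) (mean X k y) * real (n $ k)) (at (y n))" for k
      using DERIV_chain2[OF \<phi>' mean', of k] by simp
    have \<psi>m: "((\<lambda>t. \<psi> k (mean X k (y(n := t)))) has_real_derivative
        mean X k y * deriv (\<phi> k) (mean X k y) / \<phi> k (mean X k y) * real (n $ k)) (at (y n))" for k
      using DERIV_chain2[OF \<psi> mean', of k] by simp
    have lnm: "((\<lambda>t. ln (\<phi> k (mean X k (y(n := t))))) has_real_derivative
        1 / \<phi> k (mean X k y) * (deriv (\<phi> k) (mean X k y) * real (n $ k))) (at (y n))" for k
      using DERIV_chain2[OF DERIV_ln_divide \<phi>m, of k] \<phi>(1) by simp
    \<comment> \<open>This is the purpose of \<open>\<psi>\<close>: its derivative x \<phi>'(x) /
      \<phi>(x) cancels the one from ln \<phi>(x) in x ln \<phi>(x), so no \<phi>' survives.\<close>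
    have summand: "((\<lambda>t. \<psi> k (mean X k (y(n := t)))
          - mean X k (y(n := t)) * ln (\<phi> k (mean X k (y(n := t))))) has_real_derivative
        - (real (n $ k) * ln (\<phi> k (mean X k y)))) (at (y n))" for k
      by (rule DERIV_cong[OF DERIV_diff[OF \<psi>m DERIV_mult[OF mean' lnm]]]) simp
    have dZ: "((\<lambda>t. partition_function X (\<rho> (y(n := t)))) has_real_derivative dZ n y) (at (y n))"
      unfolding partition_function_def dZ_def \<rho>_def
      by (intro DERIV_sum)
         (use has_real_derivative_stationary_weight[OF \<phi>m] \<phi>(1) in \<open>simp\<close>)
    have lnZ: "((\<lambda>t. ln (partition_function X (\<rho> (y(n := t))))) has_real_derivative
        1 / partition_function X (\<rho> y) * dZ n y) (at (y n))"
      using DERIV_chain2[OF DERIV_ln_divide dZ] Z by simp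
    have "((\<lambda>t. H (y(n := t))) has_real_derivative
        lf n + (\<Sum>k\<in>UNIV. - (real (n $ k) * ln (\<phi> k (mean X k y))))
        + ((1 - 0) * ln (partition_function X (\<rho> (y(n := y n))))
           + 1 / partition_function X (\<rho> y) * dZ n y * ((\<Sum>m\<in>X. 1 * (y(n := y n)) m) - 1))) (at (y n))"
      unfolding H_def
      by (intro DERIV_add DERIV_mult DERIV_diff DERIV_const DERIV_sum lin summand lnZ)
    then show ?thesis
      by (rule DERIV_cong) (simp add: h_def sum_negf)
  qed

  have coord: "continuous_on (orthant X) (\<lambda>y. y n)" for n
    by (rule continuous_on_product_coordinates[THEN continuous_on_subset]) simp
  have mean_cont: "continuous_on (orthant X) (mean X k)" for k
    unfolding mean_def by (intro continuous_intros coord)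
  have \<phi>_cont: "continuous_on UNIV (\<phi> k)" for k
    by (intro continuous_at_imp_continuous_on ballI DERIV_isCont[OF \<phi>'])
  have \<psi>_cont: "continuous_on UNIV (\<psi> k)" for k
    by (intro continuous_at_imp_continuous_on ballI DERIV_isCont[OF \<psi>])
  note conts = continuous_on_compose2[OF \<phi>_cont mean_cont] continuous_on_compose2[OF \<psi>_cont mean_cont]
    continuous_on_compose2[OF \<phi>'_cont mean_cont] mean_cont coord
  have w_cont: "continuous_on (orthant X) (\<lambda>y. stationary_weight (\<rho> y) m)" for m
    unfolding stationary_weight_def \<rho>_def by (auto intro!: continuous_intros conts)
  have Z_cont: "continuous_on (orthant X) (\<lambda>y. partition_function X (\<rho> y))"
    unfolding partition_function_def by (intro continuous_on_sum w_cont)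
  have "continuous_on (orthant X) (dZ n)" for n
    unfolding dZ_def by (auto intro!: continuous_intros conts w_cont simp: \<phi>_nz)
  then have h_cont: "continuous_on (orthant X) (h n)" for n
    unfolding h_def by (auto intro!: continuous_intros conts Z_cont simp: \<phi>_nz Z_nz)
  have H_cont: "continuous_on (orthant X) H"
    unfolding H_def by (auto intro!: continuous_intros conts Z_cont simp: \<phi>_nz Z_nz)
  show "C1_on_orthant X g"
    by (rule C1_on_orthant_entropy_plus[where H = H and h = h, OF X(1) g H_cont dH h_cont])

  fix n y assume n: "n \<in> X" and "y \<in> prob_vectors X"
  then have y: "y \<in> orthant X" and sum_1: "(\<Sum>m\<in>X. y m) = 1"
    by (auto simp: prob_vectors_def)
  have w: "stationary_weight (\<rho> y) n > 0"
    using \<rho> by (rule stationary_weight_pos)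
  \<comment> \<open>Total mass 1 removes the \<open>dZ\<close> term, so \<open>h n y\<close> is
    minus the logarithm of the reversible distribution.\<close>
  have "h n y = ln (partition_function X (\<rho> y)) - ln (stationary_weight (\<rho> y) n)"
    using ln_stationary_weight[of "\<rho> y" n, OF \<rho>] by (simp add: h_def sum_1 lf_def \<rho>_def)
  also have "exp \<dots> = 1 / reversible_dist X (\<rho> y) n"
    using w Z[of y] by (simp add: exp_diff reversible_dist_def)
  finally have "y n * exp (1 + h n y) = y n / (reversible_dist X (\<rho> y) n / exp 1)"
    by (simp add: exp_add)
  then show "partial_deriv g n y = ereal_ln (y n / (reversible_dist X (\<rho> y) n / exp 1))"
    using partial_deriv_eqI[OF has_partial_deriv_entropy_plus[where H = H, OF X(1) n y g dH[OF n]]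
        orthant_nonneg[OF y n]]
    by simp
qed

theorem proposition4p1:
  fixes C :: nat
    and A :: "nat ^ 'k"
    and L :: "(nat ^ 'k \<Rightarrow> real) \<Rightarrow> nat ^ 'k \<Rightarrow> nat ^ 'k \<Rightarrow> real"
    and \<phi> \<psi> :: "'k \<Rightarrow> real \<Rightarrow> real"
    and \<rho> :: "(nat ^ 'k \<Rightarrow> real) \<Rightarrow> real ^ 'k"
    and g :: "(nat ^ 'k \<Rightarrow> real) \<Rightarrow> real"
  defines "\<rho> \<equiv> \<lambda>y. \<chi> k. \<phi> k (mean (states C A) k y)"
    and "g \<equiv> \<lambda>y. relative_entropy (states C A) y (reversible_dist (states C A) (\<rho> y))
                 - ln (partition_function (states C A) (\<rho> y))
                 + (\<Sum>k\<in>UNIV. \<psi> k (mean (states C A) k y))"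
  assumes "C \<ge> 1"
    and "\<And>k. 1 \<le> A $ k \<and> A $ k \<le> C"
    and "\<And>k x. \<phi> k x > 0"
    and "\<And>k. \<phi> k C1_differentiable_on UNIV"
    and "\<And>k x. (\<psi> k has_real_derivative x * deriv (\<phi> k) x / \<phi> k x) (at x)"
    and "\<And>y. y \<in> prob_vectors (states C A) \<Longrightarrow>
           \<exists>a b. (\<forall>k. a $ k > 0 \<and> b $ k > 0 \<and> a $ k / b $ k = \<rho> y $ k) \<and>
                 queue_generator C A a b (L y)"
  shows "lyapunov_function (states C A) L g"
proof -
  let ?X = "states C A"
  have fin: "finite ?X"
    using assms(4) by (intro finite_states) auto
  have ne: "?X \<noteq> {}"
    using zero_in_states by blast
  have C1: "C1_on_orthant ?X g"
    unfolding g_def \<rho>_def by (rule queue_entropy_C1(1)[OF fin ne assms(5-7)])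
  have D: "partial_deriv g n y = ereal_ln (y n / (reversible_dist ?X (\<rho> y) n / exp 1))"
    if "n \<in> ?X" "y \<in> prob_vectors ?X" for n y
    unfolding g_def \<rho>_def by (rule queue_entropy_C1(2)[OF fin ne assms(5-7) that])
  have "drift ?X L g y \<le> 0 \<and> (drift ?X L g y = 0 \<longrightarrow> (\<forall>n\<in>?X. row_mult ?X y (L y) n = 0))"
    if y: "y \<in> prob_vectors ?X" for y
  proof -
    obtain a b where ab: "\<And>k. a $ k > 0" "\<And>k. b $ k > 0" "\<And>k. a $ k / b $ k = \<rho> y $ k"
      and L: "queue_generator C A a b (L y)"
      using assms(8)[OF y] by blast
    have \<rho>: "\<rho> y $ k > 0" for k
      by (simp add: \<rho>_def assms(5))
    show ?thesis
    \<comment> \<open>The measure is the reversible distribution divided by e; this factor and the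
      partition function cancel in the balance equation.\<close>
    proof (rule drift_reversible[OF fin])
      show "y \<in> orthant ?X"
        using y by (simp add: prob_vectors_def)
      show "reversible_dist ?X (\<rho> y) n / exp 1 > 0" for n
        unfolding reversible_dist_def
        by (intro divide_pos_pos stationary_weight_pos partition_function_pos fin ne \<rho>) simp
      show "L y m n \<ge> 0" if "m \<in> ?X" "n \<in> ?X" "m \<noteq> n" for m n
        using queue_generator_nonneg[OF L ab(1,2)] that by simp
      show "(\<Sum>n\<in>?X. L y m n) = 0" if "m \<in> ?X" for m
        using L that by (simp add: queue_generator_def)
      show "reversible_dist ?X (\<rho> y) m / exp 1 * L y m n = reversible_dist ?X (\<rho> y) n / exp 1 * L y n m"
        if "m \<in> ?X" "n \<in> ?X" "m \<noteq> n" for m n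
        using queue_generator_balance[OF L ab(2,3), of m n] that by (simp add: reversible_dist_def)
      show "partial_deriv g n y = ereal_ln (y n / (reversible_dist ?X (\<rho> y) n / exp 1))" if "n \<in> ?X" for n
        using that y by (rule D)
    qed
  qed
  with C1 bdd_below_prob_vectors[OF fin] show ?thesis
    by (simp add: lyapunov_function_def C1_on_orthant_def)
qed

end
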